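(* Let $M\in\mathbb C^{n\times n}$ and $\varepsilon>0$ be fixed. Let $\Delta(t)=\operatorname{diag}(\delta_1(t)I_{r_1},\ldots,\delta_S(t)I_{r_S},\Delta_1(t),\ldots,\Delta_F(t))\in\mathbb B_1^*$, for $t$ in an interval, satisfy the differential equation $\dot\Delta=D_1P_{\mathbb B^*}(zx^* )-D_2\Delta$ associated with an eigenvalue $\lambda(t)$ of $\varepsilon M\Delta(t)$ (a continuous branch), as spelled out blockwise in the context. If $\lambda(t)$ is a simple eigenvalue of $\varepsilon M\Delta(t)$, then $|\lambda(t)|$ increases monotonically (i.e. is nondecreasing) in $t$.
   Context: Fix nonnegative integers $S,F$ and positive integers $r_i,m_j$ with $\sum_{i=1}^S r_i+\sum_{j=1}^F m_j=n$. Let $$\mathbb B^*=\{\operatorname{diag}(\delta_1 I_{r_1},\ldots,\delta_S I_{r_S},\Delta_1,\ldots,\Delta_F):\ \delta_i\in\mathbb C,\ \Delta_j\in\mathbb C^{m_j\times m_j}\},$$ $$\mathbb B_1^*=\{\operatorname{diag}(\delta_1 I_{r_1},\ldots,\delta_S I_{r_S},\Delta_1,\ldots,\Delta_F)\in\mathbb B^*:\ |\delta_i|=1,\ \|\Delta_j\|_F=1\text{ for all }i,j\},$$ where $\|\cdot\|_F$ is the Frobenius norm, with inner product $\langle A,B\rangle=\operatorname{trace}(A^*B)$. $P_{\mathbb B^*}$ denotes the orthogonal projection onto $\mathbb B^*$ with respect to this inner product. Eigenvector normalization: for a simple eigenvalue $\lambda=|\lambda|e^{\mathbf i\theta}$ of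 $\varepsilon M\Delta$, let $x,y$ be right and left eigenvectors ($y^*(\varepsilon M\Delta-\lambda I)=0$) with $\|x\|_2=\|y\|_2=1$ and $y^*x=|y^*x|e^{-\mathbf i\theta}$. Put $z=M^*y$ and partition $x=(x_1^{\rm T},\ldots,x_{S+F}^{\rm T})^{\rm T}$, $z=(z_1^{\rm T},\ldots,z_{S+F}^{\rm T})^{\rm T}$ conformally with the diagonal blocks of $\Delta$. The differential equation $\dot\Delta=D_1P_{\mathbb B^*}(zx^* )-D_2\Delta$ (where $x,z,D_1,D_2$ depend on $\Delta(t)$, with $D_1,D_2\in\mathbb B^*$ diagonal and $D_1$ positive) reads blockwise $$\dot\delta_i=\nu_i\bigl(x_i^*z_i-\operatorname{Re}(x_i^*z_i\overline{\delta}_i)\,\delta_i\bigr),\quad i=1,\ldots,S,$$ $$\dot\Delta_j=\eta_j\bigl(z_{S+j}x_{S+j}^*-\operatorname{Re}\langle\Delta_j,z_{S+j}x_{S+j}^*\rangle\,\Delta_j\bigr),\quad j=1,\ldots,F,$$ where $\nu_i>0$ is the reciprocal of the absolute value of the expression in parentheses in the first line if that is nonzero and $\nu_i=1$ otherwise, and $\eta_j>0$ is the reciprocal of the Frobenius norm of the matrix in parentheses in the second line if that is nonzero and $\eta_j=1$ otherwise. *)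

theory Defs
  imports "HOL-Analysis.Analysis" "Jordan_Normal_Form.Char_Poly"
    "Jordan_Normal_Form.Schur_Decomposition"
begin

unbundle no vec_syntax
unbundle no inner_syntax

definition vec_norm2 :: "complex vec \<Rightarrow> real" where
  "vec_norm2 v = L2_set (\<lambda>k. cmod (v $ k)) {..<dim_vec v}"

definition mat_trace :: "complex mat \<Rightarrow> complex" where
  "mat_trace A = (\<Sum>k<dim_row A. A $$ (k, k))"

definition frob_inner :: "complex mat \<Rightarrow> complex mat \<Rightarrow> complex" where
  "frob_inner A B = mat_trace (mat_adjoint A * B)"

definition frob_norm :: "complex mat \<Rightarrow> real" where
  "frob_norm A = sqrt (Re (frob_inner A A))"

text \<open>
  The product \<open>u v\<^sup>*\<close>. The scalar \<open>v\<^sup>* u\<close> is the library's \<open>u \<bullet>c v\<close>, which conjugates its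
  second argument.
\<close>

definition rank_one :: "complex vec \<Rightarrow> complex vec \<Rightarrow> complex mat" where
  "rank_one u v = mat (dim_vec u) (dim_vec v) (\<lambda>(k, l). u $ k * cnj (v $ l))"

definition simple_eigenvalue :: "complex mat \<Rightarrow> complex \<Rightarrow> bool" where
  "simple_eigenvalue A l \<longleftrightarrow> Polynomial.order l (char_poly A) = 1"

text \<open>
  \<open>y \<noteq> 0\<close> with \<open>y\<^sup>* (A - l I) = 0\<close>; the row vector \<open>y\<^sup>*\<close> is transposed into the column
  \<open>conjugate y\<close>.
\<close>

definition left_eigenvector :: "complex mat \<Rightarrow> complex vec \<Rightarrow> complex \<Rightarrow> bool" where
  "left_eigenvector A y l \<longleftrightarrow>
     y \<in> carrier_vec (dim_row A) \<and> y \<noteq> 0\<^sub>v (dim_row A) \<and>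
     transpose_mat (A - l \<cdot>\<^sub>m 1\<^sub>m (dim_row A)) *\<^sub>v conjugate y = 0\<^sub>v (dim_row A)"

text \<open>
  The angle \<open>th\<close> is an argument of \<open>l\<close>; it is arbitrary if \<open>l = 0\<close>.
\<close>

definition normalized_eigenvectors ::
  "complex mat \<Rightarrow> complex \<Rightarrow> real \<Rightarrow> complex vec \<Rightarrow> complex vec \<Rightarrow> bool" where
  "normalized_eigenvectors A l th x y \<longleftrightarrow>
     l = complex_of_real (cmod l) * cis th \<and>
     eigenvector A x l \<and> left_eigenvector A y l \<and>
     vec_norm2 x = 1 \<and> vec_norm2 y = 1 \<and>
     x \<bullet>c y = complex_of_real (cmod (x \<bullet>c y)) * cis (- th)"

text \<open>
  Blocks are indexed from 0: block \<open>k < S\<close> is the repeated scalar block of size \<open>r k\<close>, and block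
  \<open>S + j\<close> with \<open>j < F\<close> is the full block of size \<open>m j\<close>.
\<close>

definition structured_mat ::
  "nat \<Rightarrow> nat \<Rightarrow> (nat \<Rightarrow> nat) \<Rightarrow> (nat \<Rightarrow> complex) \<Rightarrow> (nat \<Rightarrow> complex mat) \<Rightarrow> complex mat" where
  "structured_mat S F r d D =
     diag_block_mat (map (\<lambda>i. d i \<cdot>\<^sub>m 1\<^sub>m (r i)) [0..<S] @ map D [0..<F])"

definition B1_star :: "nat \<Rightarrow> nat \<Rightarrow> (nat \<Rightarrow> nat) \<Rightarrow> (nat \<Rightarrow> nat) \<Rightarrow> complex mat set" where
  "B1_star S F r m =
     {structured_mat S F r d D | d D.
        (\<forall>i<S. cmod (d i) = 1) \<and>
        (\<forall>j<F. D j \<in> carrier_mat (m j) (m j) \<and> frob_norm (D j) = 1)}"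

definition block_size :: "nat \<Rightarrow> (nat \<Rightarrow> nat) \<Rightarrow> (nat \<Rightarrow> nat) \<Rightarrow> nat \<Rightarrow> nat" where
  "block_size S r m k = (if k < S then r k else m (k - S))"

definition vec_block ::
  "nat \<Rightarrow> (nat \<Rightarrow> nat) \<Rightarrow> (nat \<Rightarrow> nat) \<Rightarrow> complex vec \<Rightarrow> nat \<Rightarrow> complex vec" where
  "vec_block S r m v k =
     vec (block_size S r m k) (\<lambda>a. v $ ((\<Sum>l<k. block_size S r m l) + a))"

definition recip_or_one :: "real \<Rightarrow> real" where
  "recip_or_one c = (if c = 0 then 1 else 1 / c)"

text \<open>
  Right-hand sides for a scalar block \<open>d I\<close> and for a full block \<open>D\<close>; here \<open>x\<close> and \<open>z\<close> are the
  parts of the two vectors that belong to the block.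
\<close>

definition scalar_block_rhs :: "complex vec \<Rightarrow> complex vec \<Rightarrow> complex \<Rightarrow> complex" where
  "scalar_block_rhs x z d =
     (let e = z \<bullet>c x - complex_of_real (Re ((z \<bullet>c x) * cnj d)) * d
      in complex_of_real (recip_or_one (cmod e)) * e)"

definition full_block_rhs :: "complex vec \<Rightarrow> complex vec \<Rightarrow> complex mat \<Rightarrow> complex mat" where
  "full_block_rhs x z D =
     (let E = rank_one z x - complex_of_real (Re (frob_inner D (rank_one z x))) \<cdot>\<^sub>m D
      in complex_of_real (recip_or_one (frob_norm E)) \<cdot>\<^sub>m E)"

end

theory Submission
  imports Defs
begin

text \<open>
  The squared modulus of the eigenvalue is differentiable along the flow and its derivative is
  nonnegative. Working with the square has the advantage that no time at which the eigenvalue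
  vanishes needs separate treatment.

  The first ingredient is the perturbation formula for a simple eigenvalue \<open>\<lambda>\<close> of a differentiable
  matrix path \<open>A\<close> with right and left eigenvectors \<open>x\<close>, \<open>y\<close>:
  \<open>\<lambda>' = y\<^sup>* A' x / (y\<^sup>* x)\<close>, where \<open>y\<^sup>* x \<noteq> 0\<close> because the eigenvalue is simple
  (\<open>simple_eigenvalue_pairing_nonzero\<close>, \<open>simple_eigenvalue_has_vector_derivative\<close>).
  No regularity of the given eigenvector path is known. Instead, Cramer's rule for the bordered
  matrix \<open>A - \<lambda> I + x y\<^sup>*\<close>, which is invertible near the time considered, produces eigenvectors
  that depend continuously on time; this uses only the continuity of \<open>A\<close> and \<open>\<lambda>\<close>.

  For \<open>A = \<epsilon> M \<Delta>\<close> and \<open>z = M\<^sup>* y\<close> the numerator is \<open>\<epsilon> z\<^sup>* \<Delta>' x\<close>. The normalization of the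
  eigenvectors makes \<open>y\<^sup>* x\<close> a nonnegative multiple of \<open>e\<^sup>-\<^sup>i\<^sup>\<theta>\<close>, the phase of the conjugate
  of \<open>\<lambda>\<close>. The two phases cancel and
  \<open>Re (cnj \<lambda> \<lambda>')\<close> is a nonnegative multiple of \<open>Re (z\<^sup>* \<Delta>' x)\<close>.

  This form splits over the diagonal blocks (\<open>structured_mat_bilinear_form\<close>). On each block it is the
  real inner product of \<open>\<Delta>'\<close> with the block of \<open>z x\<^sup>*\<close>, or with its trace for a repeated scalar.
  The right-hand side of the equation is a positive multiple of the projection of that very quantity
  onto the tangent space of the unit sphere at the current block, and the real inner product of a
  vector with its projection is the squared norm of the projection, hence nonnegative
  (\<open>tangent_projection_nonneg\<close>).
\<close>

section \<open>Eigenvectors of a simple eigenvalue\<close>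

lemma order_linear_factors:
  fixes l :: complex
  shows "Polynomial.order l (\<Prod>e\<leftarrow>es. [:- e, 1:]) = count_list es l"
proof (induction es)
  case Nil
  then show ?case by (simp add: order_1_eq_0)
next
  case (Cons e es)
  have "(\<Prod>e\<leftarrow>es. [:- e, 1:]) \<noteq> 0"
    by (auto simp: prod_list_zero_iff)
  then have "[:- e, 1:] * (\<Prod>e\<leftarrow>es. [:- e, 1:]) \<noteq> 0"
    by (intro no_zero_divisors) auto
  from order_mult[OF this, of l] show ?case
    using Cons by (simp add: order_linear')
qed

text \<open>
  A Schur decomposition can list the eigenvalues in any order. With the simple eigenvalue first, all
  later diagonal entries differ from it, which lets triangular systems be solved by substitution.
\<close>

lemma simple_eigenvalue_schur:
  assumes A: "A \<in> carrier_mat n n" and simple: "simple_eigenvalue A l"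
  obtains B P Q where "similar_mat_wit A B P Q" "upper_triangular B" "B \<in> carrier_mat n n" "0 < n"
    "B $$ (0, 0) = l" "\<And>k. 0 < k \<Longrightarrow> k < n \<Longrightarrow> B $$ (k, k) \<noteq> l"
proof -
  obtain as where as: "char_poly A = (\<Prod>a\<leftarrow>as. [:- a, 1:])" "length as = n"
    using char_poly_factorized[OF A] by blast
  with simple have cnt: "count_list as l = 1"
    by (simp add: simple_eigenvalue_def order_linear_factors)
  then have "l \<in> set as"
    by (metis count_list_0_iff zero_neq_one)
  define es where "es = l # remove1 l as"
  have "mset es = mset as"
    using \<open>l \<in> set as\<close> by (simp add: es_def)
  then have prod: "char_poly A = (\<Prod>e\<leftarrow>es. [:- e, 1:])"
    unfolding as(1) by (simp only: prod_mset_prod_list[symmetric] mset_map \<open>mset es = mset as\<close>)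
  have "count_list es l = 1"
    using cnt \<open>mset es = mset as\<close> by (metis count_mset)
  then have "count_list (remove1 l as) l + 1 = 1"
    by (simp only: es_def count_list.simps if_True refl)
  then have notin: "l \<notin> set (remove1 l as)"
    by (metis add_cancel_left_left count_list_0_iff)
  obtain B P Q where "schur_decomposition A es = (B, P, Q)"
    by (metis prod_cases3)
  from schur_decomposition[OF A prod this]
  have sim: "similar_mat_wit A B P Q" and upper: "upper_triangular B" and diag: "diag_mat B = es"
    by auto
  have B: "B \<in> carrier_mat n n"
    using similar_mat_witD2[OF A sim] by blast
  have n: "length es = n"
    using \<open>mset es = mset as\<close> as(2) mset_eq_length by blast
  have entry: "B $$ (k, k) = es ! k" if "k < n" for k
    using arg_cong[OF diag, of "\<lambda>xs. xs ! k"] that B by (simp add: diag_mat_def)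
  have "0 < n"
    using n by (simp add: es_def)
  show thesis
  proof (rule that[OF sim upper B \<open>0 < n\<close>])
    show "B $$ (0, 0) = l"
      using entry[OF \<open>0 < n\<close>] by (simp add: es_def)
    fix k assume "0 < k" "k < n"
    then have "es ! k \<in> set (remove1 l as)"
      using n by (auto simp: es_def nth_Cons')
    with notin show "B $$ (k, k) \<noteq> l"
      using entry[OF \<open>k < n\<close>] by auto
  qed
qed

text \<open>
  Back substitution: the rows of \<open>B v = l v\<close>, read from the bottom, annihilate one entry after the
  other, up to the row in which the diagonal entry may equal \<open>l\<close>.
\<close>

lemma upper_triangular_right_eigenvector:
  fixes B :: "complex mat"
  assumes B: "B \<in> carrier_mat n n" "upper_triangular B" and v: "v \<in> carrier_vec n"
    and ev: "B *\<^sub>v v = l \<cdot>\<^sub>v v" and diag: "\<And>k. 0 < k \<Longrightarrow> k < n \<Longrightarrow> B $$ (k, k) \<noteq> l"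
    and k: "0 < k" "k < n"
  shows "v $ k = 0"
  using k
proof (induction "n - k" arbitrary: k rule: less_induct)
  case less
  have "l * v $ k = (B *\<^sub>v v) $ k"
    using less.prems v by (simp add: ev)
  also have "\<dots> = (\<Sum>i\<in>{0..<n}. B $$ (k, i) * v $ i)"
    using less.prems v B by (simp add: scalar_prod_def)
  also have "\<dots> = (\<Sum>i\<in>{0..<n}. if i = k then B $$ (k, k) * v $ k else 0)"
  proof (intro sum.cong refl)
    fix i assume i: "i \<in> {0..<n}"
    consider "i < k" | "i = k" | "k < i" by linarith
    then show "B $$ (k, i) * v $ i = (if i = k then B $$ (k, k) * v $ k else 0)"
    proof cases
      case 1
      then show ?thesis
        using B less.prems by auto
    next
      case 3
      then have "v $ i = 0"
        using less.hyps[of i] less.prems i by auto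
      then show ?thesis using 3 by simp
    qed simp
  qed
  also have "\<dots> = B $$ (k, k) * v $ k"
    using less.prems by simp
  finally show ?case
    using diag[OF less.prems] by simp
qed

text \<open>
  Forward substitution, the mirror image for left eigenvectors: the first entry is the only one
  that the columns of \<open>B\<close> leave undetermined.
\<close>

lemma upper_triangular_left_eigenvector:
  fixes B :: "complex mat"
  assumes B: "B \<in> carrier_mat n n" "upper_triangular B" and w: "w \<in> carrier_vec n"
    and ev: "transpose_mat B *\<^sub>v w = l \<cdot>\<^sub>v w" and diag: "\<And>k. 0 < k \<Longrightarrow> k < n \<Longrightarrow> B $$ (k, k) \<noteq> l"
    and w0: "w $ 0 = 0"
  shows "w = 0\<^sub>v n"
proof -
  have "w $ k = 0" if "k < n" for k
    using that
  proof (induction k rule: less_induct)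
    case (less k)
    show ?case
    proof (cases "k = 0")
      case False
      have "l * w $ k = (transpose_mat B *\<^sub>v w) $ k"
        using less.prems w by (simp add: ev)
      also have "\<dots> = (\<Sum>i\<in>{0..<n}. B $$ (i, k) * w $ i)"
        using less.prems w B by (simp add: scalar_prod_def)
      also have "\<dots> = (\<Sum>i\<in>{0..<n}. if i = k then B $$ (k, k) * w $ k else 0)"
      proof (intro sum.cong refl)
        fix i assume i: "i \<in> {0..<n}"
        consider "i < k" | "i = k" | "k < i" by linarith
        then show "B $$ (i, k) * w $ i = (if i = k then B $$ (k, k) * w $ k else 0)"
        proof cases
          case 1
          then show ?thesis
            using less.IH[of i] less.prems by auto
        next
          case 3
          then show ?thesis using B i by auto
        qed simp
      qed
      also have "\<dots> = B $$ (k, k) * w $ k"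
        using less.prems by simp
      finally show ?thesis
        using diag[of k] False less.prems by simp
    qed (simp add: w0)
  qed
  with w show ?thesis by auto
qed

lemma transpose_left_eigenvector:
  assumes A: "A \<in> carrier_mat n n" and y: "left_eigenvector A y l"
  shows "transpose_mat A *\<^sub>v conjugate y = l \<cdot>\<^sub>v conjugate y"
proof -
  have yc: "y \<in> carrier_vec n"
    and eq: "transpose_mat (A - l \<cdot>\<^sub>m 1\<^sub>m n) *\<^sub>v conjugate y = 0\<^sub>v n"
    using y A by (auto simp: left_eigenvector_def)
  have "transpose_mat (A - l \<cdot>\<^sub>m 1\<^sub>m n) *\<^sub>v conjugate y
      = transpose_mat A *\<^sub>v conjugate y - l \<cdot>\<^sub>v conjugate y"
  proof (rule eq_vecI)
    fix i assume "i < dim_vec (transpose_mat A *\<^sub>v conjugate y - l \<cdot>\<^sub>v conjugate y)"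
    then have i: "i < n" using yc by simp
    show "(transpose_mat (A - l \<cdot>\<^sub>m 1\<^sub>m n) *\<^sub>v conjugate y) $ i
        = (transpose_mat A *\<^sub>v conjugate y - l \<cdot>\<^sub>v conjugate y) $ i"
      using i yc A
      by (simp add: scalar_prod_def left_diff_distrib sum_subtractf sum_distrib_left[symmetric] if_distrib[of "\<lambda>c. l * c * _"]
          if_distrib[of "\<lambda>c. c * _"] mult.assoc cong: if_cong)
  qed (use A yc in auto)
  then have "transpose_mat A *\<^sub>v conjugate y - l \<cdot>\<^sub>v conjugate y = 0\<^sub>v n"
    using eq by simp
  then have "(transpose_mat A *\<^sub>v conjugate y) $ i - (l \<cdot>\<^sub>v conjugate y) $ i = 0" if "i < n" for i
    using that yc by (metis carrier_vec_conjugate carrier_vecD index_minus_vec(1) index_smult_vec(2) index_zero_vec(1))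
  then show ?thesis
    using A yc by (intro eq_vecI) auto
qed

text \<open>
  In Schur coordinates the right eigenvector is supported on its first entry and the left eigenvector
  has a nonzero first entry, so their pairing is the product of two nonzero numbers.
  A Jordan block of size two shows that simplicity is essential.
\<close>

lemma simple_eigenvalue_pairing_nonzero:
  assumes A: "A \<in> carrier_mat n n" and simple: "simple_eigenvalue A l"
    and u: "eigenvector A u l" and y: "left_eigenvector A y l"
  shows "u \<bullet>c y \<noteq> 0"
proof -
  obtain B P Q where sim: "similar_mat_wit A B P Q" and upper: "upper_triangular B"
    and B: "B \<in> carrier_mat n n" and "0 < n" "B $$ (0, 0) = l"
    and diag: "\<And>k. 0 < k \<Longrightarrow> k < n \<Longrightarrow> B $$ (k, k) \<noteq> l"
    using simple_eigenvalue_schur[OF A simple] by blast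
  note [simp] = similar_mat_witD2(4-7)[OF A sim]
  note PQ = similar_mat_witD2(1)[OF A sim] and QP = similar_mat_witD2(2)[OF A sim]
    and APBQ = similar_mat_witD2(3)[OF A sim]
  have uc[simp]: "u \<in> carrier_vec n" and u0: "u \<noteq> 0\<^sub>v n" and Au: "A *\<^sub>v u = l \<cdot>\<^sub>v u"
    using u A by (auto simp: eigenvector_def)
  have yc: "y \<in> carrier_vec n" and y0: "y \<noteq> 0\<^sub>v n"
    using y A by (auto simp: left_eigenvector_def)
  define c where "c = conjugate y"
  have cc[simp]: "c \<in> carrier_vec n" and c0: "c \<noteq> 0\<^sub>v n"
    using yc y0 by (auto simp: c_def)
  have Ac: "transpose_mat A *\<^sub>v c = l \<cdot>\<^sub>v c"
    using transpose_left_eigenvector[OF A y] by (simp add: c_def)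
  define v where "v = Q *\<^sub>v u"
  define w where "w = transpose_mat P *\<^sub>v c"
  have vc[simp]: "v \<in> carrier_vec n" and wc[simp]: "w \<in> carrier_vec n"
    by (auto simp: v_def w_def intro!: mult_mat_vec_carrier[of _ n n])
  have QA: "Q * A = B * Q"
  proof -
    have BQ: "B * Q \<in> carrier_mat n n"
      by (rule mult_carrier_mat[of _ n n]) auto
    have "Q * A = Q * (P * (B * Q))"
      unfolding APBQ by (simp add: assoc_mult_mat[of P n n B n Q n])
    also have "\<dots> = (Q * P) * (B * Q)"
      by (rule assoc_mult_mat[symmetric, of _ n n _ n _ n]) (use BQ in auto)
    finally show ?thesis
      by (simp add: QP left_mult_one_mat[OF BQ])
  qed
  have AP: "A * P = P * B"
  proof -
    have PB: "P * B \<in> carrier_mat n n"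
      by (rule mult_carrier_mat[of _ n n]) auto
    have "A * P = (P * B) * (Q * P)"
      unfolding APBQ by (rule assoc_mult_mat[of _ n n _ n _ n]) (use PB in auto)
    then show ?thesis
      by (simp add: QP right_mult_one_mat[OF PB])
  qed
  have Bv: "B *\<^sub>v v = l \<cdot>\<^sub>v v"
  proof -
    have "B *\<^sub>v v = (Q * A) *\<^sub>v u"
      unfolding QA v_def by (rule assoc_mult_mat_vec[symmetric, of _ n n _ n]) auto
    also have "\<dots> = Q *\<^sub>v (l \<cdot>\<^sub>v u)"
      unfolding Au[symmetric] by (rule assoc_mult_mat_vec[of _ n n _ n]) auto
    finally show ?thesis
      by (simp add: v_def mult_mat_vec[of _ n n])
  qed
  have Bw: "transpose_mat B *\<^sub>v w = l \<cdot>\<^sub>v w"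
  proof -
    have "transpose_mat B *\<^sub>v w = (transpose_mat (P * B)) *\<^sub>v c"
      unfolding w_def
      by (subst transpose_mult[of _ n n _ n]) (auto intro!: assoc_mult_mat_vec[symmetric, of _ n n _ n])
    also have "\<dots> = transpose_mat P *\<^sub>v (transpose_mat A *\<^sub>v c)"
      unfolding AP[symmetric]
      by (subst transpose_mult[of _ n n _ n]) (auto intro!: assoc_mult_mat_vec[of _ n n _ n])
    finally show ?thesis
      by (simp add: Ac w_def mult_mat_vec[of _ n n])
  qed
  have Pv: "u = P *\<^sub>v v"
    unfolding v_def using assoc_mult_mat_vec[of P n n Q n u] by (simp add: PQ)
  have Qw: "c = transpose_mat Q *\<^sub>v w"
    unfolding w_def using assoc_mult_mat_vec[of "transpose_mat Q" n n "transpose_mat P" n c]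
    by (simp add: PQ transpose_mult[symmetric, of _ n n _ n])
  have vk: "v $ k = 0" if "0 < k" "k < n" for k
    using upper_triangular_right_eigenvector[OF B upper vc Bv diag] that by blast
  have "v $ 0 \<noteq> 0"
  proof
    assume "v $ 0 = 0"
    then have "v $ k = 0" if "k < n" for k using vk[of k] that by (cases "k = 0") auto
    then have "v = 0\<^sub>v n" by (intro eq_vecI) (use vc in auto)
    then have "u = 0\<^sub>v n" unfolding Pv \<open>v = 0\<^sub>v n\<close> by (intro eq_vecI) (use carrier_matD[OF similar_mat_witD2(6)[OF A sim]] in \<open>auto simp: scalar_prod_def\<close>)
    with u0 show False by simp
  qed
  moreover have "w $ 0 \<noteq> 0"
  proof
    assume "w $ 0 = 0"
    then have "w = 0\<^sub>v n"
      using upper_triangular_left_eigenvector[OF B upper wc Bw diag] by blast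
    then have "c = 0\<^sub>v n" unfolding Qw \<open>w = 0\<^sub>v n\<close> by (intro eq_vecI) (use carrier_matD[OF similar_mat_witD2(7)[OF A sim]] in \<open>auto simp: scalar_prod_def\<close>)
    with c0 show False by simp
  qed
  moreover have "u \<bullet> c = w $ 0 * v $ 0"
  proof -
    have "u \<bullet> c = c \<bullet> (P *\<^sub>v v)"
      unfolding Pv[symmetric] by (rule comm_scalar_prod[of _ n]) auto
    also have "\<dots> = w \<bullet> v"
      unfolding w_def by (rule transpose_vec_mult_scalar[symmetric, of _ n n]) auto
    also have "\<dots> = (\<Sum>k\<in>{0..<n}. if k = 0 then w $ 0 * v $ 0 else 0)"
      unfolding scalar_prod_def carrier_vecD[OF vc] using vk by (intro sum.cong) auto
    finally show ?thesis using \<open>0 < n\<close> by simp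
  qed
  ultimately show ?thesis by (simp add: c_def)
qed

lemma bilinear_form_sum:
  fixes A :: "complex mat"
  assumes A: "A \<in> carrier_mat n n" and u: "u \<in> carrier_vec n" and y: "y \<in> carrier_vec n"
  shows "(A *\<^sub>v u) \<bullet>c y = (\<Sum>i<n. \<Sum>j<n. cnj (y $ i) * A $$ (i, j) * u $ j)"
proof -
  have "(A *\<^sub>v u) \<bullet>c y = (\<Sum>i<n. (\<Sum>j<n. A $$ (i, j) * u $ j) * cnj (y $ i))"
    using assms by (simp add: scalar_prod_def atLeast0LessThan)
  then show ?thesis
    by (simp add: sum_distrib_left sum_distrib_right mult_ac)
qed

lemma bilinear_form_left_eigenvector:
  assumes A: "A \<in> carrier_mat n n" and u: "u \<in> carrier_vec n" and y: "left_eigenvector A y l"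
  shows "(A *\<^sub>v u) \<bullet>c y = l * (u \<bullet>c y)"
proof -
  have yc: "y \<in> carrier_vec n"
    using y A by (simp add: left_eigenvector_def)
  have "l * (u \<bullet>c y) = (l \<cdot>\<^sub>v conjugate y) \<bullet> u"
    using u yc comm_scalar_prod[of u n "conjugate y"] by simp
  also have "\<dots> = conjugate y \<bullet> (A *\<^sub>v u)"
    unfolding transpose_left_eigenvector[OF A y, symmetric]
    using u yc A by (intro transpose_vec_mult_scalar) auto
  finally show ?thesis
    using u yc A comm_scalar_prod[of "A *\<^sub>v u" n "conjugate y"] by simp
qed

section \<open>Perturbation of a simple eigenvalue\<close>

text \<open>
  The matrix \<open>A - l I + x y\<^sup>*\<close>. The dimension is an argument so that the result is an \<open>n\<close> by \<open>n\<close> matrix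
  for every \<open>A\<close>; limits along a path can then be taken without restricting to the times at which
  the path has the right dimensions.
\<close>

definition bordered_mat ::
  "nat \<Rightarrow> complex mat \<Rightarrow> complex \<Rightarrow> complex vec \<Rightarrow> complex vec \<Rightarrow> complex mat" where
  "bordered_mat n A l x y =
     mat n n (\<lambda>(i, j). A $$ (i, j) - (if i = j then l else 0) + x $ i * cnj (y $ j))"

lemma bordered_mat_carrier [simp]: "bordered_mat n A l x y \<in> carrier_mat n n"
  by (simp add: bordered_mat_def)

lemma index_bordered_mat_mult_vec:
  assumes A: "A \<in> carrier_mat n n" and u: "u \<in> carrier_vec n" and y: "y \<in> carrier_vec n"
    and i: "i < n"
  shows "(bordered_mat n A l x y *\<^sub>v u) $ i = (A *\<^sub>v u) $ i - l * u $ i + (u \<bullet>c y) * x $ i"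
proof -
  have "(bordered_mat n A l x y *\<^sub>v u) $ i
      = (\<Sum>k\<in>{0..<n}. (A $$ (i, k) - (if i = k then l else 0) + x $ i * cnj (y $ k)) * u $ k)"
    using assms by (simp add: bordered_mat_def scalar_prod_def)
  also have "\<dots> = (\<Sum>k\<in>{0..<n}. A $$ (i, k) * u $ k - (if i = k then l * u $ k else 0)
      + u $ k * cnj (y $ k) * x $ i)"
    by (intro sum.cong) (auto simp: algebra_simps)
  also have "\<dots> = (\<Sum>k\<in>{0..<n}. A $$ (i, k) * u $ k) - l * u $ i
      + (\<Sum>k\<in>{0..<n}. u $ k * cnj (y $ k)) * x $ i"
    using i by (simp add: sum.distrib sum_subtractf sum_distrib_right)
  finally show ?thesis
    using assms by (simp add: scalar_prod_def)
qed

text \<open>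
  If the bordered matrix annihilates \<open>u\<close>, then multiplication by \<open>y\<^sup>*\<close> gives \<open>(y\<^sup>* u) (y\<^sup>* x) = 0\<close>, so
  \<open>y\<^sup>* u = 0\<close>. Hence \<open>u\<close> lies in the kernel of \<open>A - l I\<close>, and a nonzero such \<open>u\<close> would be an
  eigenvector with vanishing pairing.
\<close>

lemma bordered_mat_det_nonzero:
  assumes A: "A \<in> carrier_mat n n" and simple: "simple_eigenvalue A l"
    and x: "eigenvector A x l" and y: "left_eigenvector A y l"
  shows "det (bordered_mat n A l x y) \<noteq> 0"
proof
  assume "det (bordered_mat n A l x y) = 0"
  then obtain u where u: "u \<in> carrier_vec n" "u \<noteq> 0\<^sub>v n" "bordered_mat n A l x y *\<^sub>v u = 0\<^sub>v n"
    using det_0_iff_vec_prod_zero_field[of "bordered_mat n A l x y" n] by auto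
  have xc: "x \<in> carrier_vec n" and yc: "y \<in> carrier_vec n"
    using x y A by (auto simp: eigenvector_def left_eigenvector_def)
  have Au: "A *\<^sub>v u = l \<cdot>\<^sub>v u + (- (u \<bullet>c y)) \<cdot>\<^sub>v x"
  proof (rule eq_vecI)
    fix i assume "i < dim_vec (l \<cdot>\<^sub>v u + (- (u \<bullet>c y)) \<cdot>\<^sub>v x)"
    then have i: "i < n" using xc u by simp
    have "(A *\<^sub>v u) $ i - l * u $ i + (u \<bullet>c y) * x $ i = 0"
      using index_bordered_mat_mult_vec[OF A u(1) yc i, of l x] i u(3) by simp
    then show "(A *\<^sub>v u) $ i = (l \<cdot>\<^sub>v u + (- (u \<bullet>c y)) \<cdot>\<^sub>v x) $ i"
      using i xc u(1) by (simp add: algebra_simps)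
  qed (use A xc in auto)
  have "l * (u \<bullet>c y) = (A *\<^sub>v u) \<bullet>c y"
    by (rule bilinear_form_left_eigenvector[OF A u(1) y, symmetric])
  also have "\<dots> = l * (u \<bullet>c y) - (u \<bullet>c y) * (x \<bullet>c y)"
    unfolding Au using u xc yc by (simp add: add_scalar_prod_distrib[of _ n])
  finally have "u \<bullet>c y = 0"
    using simple_eigenvalue_pairing_nonzero[OF A simple x y] by simp
  then have "A *\<^sub>v u = l \<cdot>\<^sub>v u"
    unfolding Au using u xc by (intro eq_vecI) auto
  then have "eigenvector A u l"
    using u A by (simp add: eigenvector_def)
  from simple_eigenvalue_pairing_nonzero[OF A simple this y] \<open>u \<bullet>c y = 0\<close>
  show False by simp
qed

lemma tendsto_det:
  fixes G :: "'a \<Rightarrow> complex mat"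
  assumes G: "\<And>t. G t \<in> carrier_mat n n" and L: "L \<in> carrier_mat n n"
    and lim: "\<And>i j. i < n \<Longrightarrow> j < n \<Longrightarrow> ((\<lambda>t. G t $$ (i, j)) \<longlongrightarrow> L $$ (i, j)) F"
  shows "((\<lambda>t. det (G t)) \<longlongrightarrow> det L) F"
  unfolding det_def'[OF G] det_def'[OF L]
  by (intro tendsto_sum tendsto_mult tendsto_const tendsto_prod lim)
     (auto dest: permutes_in_image)

lemma tendsto_adj_mat:
  fixes G :: "'a \<Rightarrow> complex mat"
  assumes G: "\<And>t. G t \<in> carrier_mat n n" and L: "L \<in> carrier_mat n n"
    and lim: "\<And>i j. i < n \<Longrightarrow> j < n \<Longrightarrow> ((\<lambda>t. G t $$ (i, j)) \<longlongrightarrow> L $$ (i, j)) F"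
    and i: "i < n" and j: "j < n"
  shows "((\<lambda>t. adj_mat (G t) $$ (i, j)) \<longlongrightarrow> adj_mat L $$ (i, j)) F"
proof -
  have "((\<lambda>t. det (mat_delete (G t) j i)) \<longlongrightarrow> det (mat_delete L j i)) F"
  proof (rule tendsto_det)
    show "mat_delete (G t) j i \<in> carrier_mat (n - 1) (n - 1)" for t
      using G[of t] by (simp add: mat_delete_def)
    show "mat_delete L j i \<in> carrier_mat (n - 1) (n - 1)"
      using L by (simp add: mat_delete_def)
    fix k l assume "k < n - 1" "l < n - 1"
    then show "((\<lambda>t. mat_delete (G t) j i $$ (k, l)) \<longlongrightarrow> mat_delete L j i $$ (k, l)) F"
      using carrier_matD[OF G] carrier_matD[OF L] by (auto simp: mat_delete_def intro!: lim)
  qed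
  then show ?thesis
    using i j carrier_matD[OF G] carrier_matD[OF L]
    by (auto simp: adj_mat_def cofactor_def intro!: tendsto_intros)
qed

lemma has_vector_derivative_iff_quotient:
  fixes f :: "real \<Rightarrow> 'a::real_normed_vector"
  shows "(f has_vector_derivative D) (at x within S) \<longleftrightarrow>
    ((\<lambda>y. (f y - f x) /\<^sub>R (y - x)) \<longlongrightarrow> D) (at x within S)"
proof -
  have "((\<lambda>y. norm (f y - f x - (y - x) *\<^sub>R D) / norm (y - x)) \<longlongrightarrow> 0) (at x within S)
      \<longleftrightarrow> ((\<lambda>y. norm ((f y - f x) /\<^sub>R (y - x) - D)) \<longlongrightarrow> 0) (at x within S)"
  proof (rule filterlim_cong[OF refl refl])
    have "norm (f y - f x - (y - x) *\<^sub>R D) / norm (y - x) = norm ((f y - f x) /\<^sub>R (y - x) - D)"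
      if "y \<noteq> x" for y
    proof -
      have "f y - f x - (y - x) *\<^sub>R D = (y - x) *\<^sub>R ((f y - f x) /\<^sub>R (y - x) - D)"
        using that by (simp add: scaleR_diff_right)
      then show ?thesis using that by simp
    qed
    then show "\<forall>\<^sub>F y in at x within S.
        norm (f y - f x - (y - x) *\<^sub>R D) / norm (y - x) = norm ((f y - f x) /\<^sub>R (y - x) - D)"
      by (auto simp: eventually_at_filter)
  qed
  then show ?thesis
    by (simp add: has_vector_derivative_def has_derivative_iff_norm bounded_linear_scaleR_left
        tendsto_norm_zero_iff Lim_null[symmetric])
qed

text \<open>
  An eigenvector \<open>u\<close> for \<open>l\<close> satisfies \<open>G u = (y\<^sup>* u) x\<close> for the bordered matrix \<open>G\<close>. If \<open>G\<close> is
  invertible, this identifies \<open>G\<^sup>-\<^sup>1 x\<close> as the eigenvector normalized by \<open>y\<^sup>* v = 1\<close>, and Cramer's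
  rule makes it a continuous function of the data. Here \<open>x\<close>, \<open>y\<close> may belong to a different matrix,
  in particular to a nearby point of a path.
\<close>

lemma bordered_mat_solution:
  assumes A: "A \<in> carrier_mat n n" and x: "x \<in> carrier_vec n" and y: "y \<in> carrier_vec n"
    and u: "eigenvector A u l" and det: "det (bordered_mat n A l x y) \<noteq> 0"
  defines "v \<equiv> inverse (det (bordered_mat n A l x y)) \<cdot>\<^sub>v (adj_mat (bordered_mat n A l x y) *\<^sub>v x)"
  shows "u \<bullet>c y \<noteq> 0" and "v = inverse (u \<bullet>c y) \<cdot>\<^sub>v u"
proof -
  let ?G = "bordered_mat n A l x y"
  have u: "u \<in> carrier_vec n" "u \<noteq> 0\<^sub>v n" "A *\<^sub>v u = l \<cdot>\<^sub>v u"
    using u A by (auto simp: eigenvector_def)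
  have Gu: "?G *\<^sub>v u = (u \<bullet>c y) \<cdot>\<^sub>v x"
    using x u(1) by (intro eq_vecI)
      (auto simp: index_bordered_mat_mult_vec[OF A u(1) y] u(3) carrier_matD[OF bordered_mat_carrier] simp del: index_mult_mat_vec)
  show s: "u \<bullet>c y \<noteq> 0"
  proof
    assume "u \<bullet>c y = 0"
    then have "?G *\<^sub>v u = 0\<^sub>v n"
      using Gu x by auto
    with u det det_0_iff_vec_prod_zero_field[of ?G n] show False by auto
  qed
  have adj: "adj_mat ?G \<in> carrier_mat n n" "adj_mat ?G * ?G = det ?G \<cdot>\<^sub>m 1\<^sub>m n"
    using adj_mat[of ?G n] by simp_all
  have "det ?G \<cdot>\<^sub>v u = (adj_mat ?G * ?G) *\<^sub>v u"
    unfolding adj(2) using u(1) by (intro eq_vecI) simp_all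
  also have "\<dots> = adj_mat ?G *\<^sub>v ((u \<bullet>c y) \<cdot>\<^sub>v x)"
    unfolding Gu[symmetric] using adj u by (intro assoc_mult_mat_vec[of _ n n]) auto
  also have "\<dots> = (u \<bullet>c y) \<cdot>\<^sub>v (adj_mat ?G *\<^sub>v x)"
    using adj x by (intro mult_mat_vec)
  finally have eq: "det ?G \<cdot>\<^sub>v u = (u \<bullet>c y) \<cdot>\<^sub>v (adj_mat ?G *\<^sub>v x)" .
  show "v = inverse (u \<bullet>c y) \<cdot>\<^sub>v u"
  proof (rule eq_vecI)
    fix i assume "i < dim_vec (inverse (u \<bullet>c y) \<cdot>\<^sub>v u)"
    then have i: "i < n" using u by simp
    have "det ?G * u $ i = (u \<bullet>c y) * (adj_mat ?G *\<^sub>v x) $ i"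
      using arg_cong[OF eq, of "\<lambda>w. w $ i"] i u(1) adj x by (simp del: index_mult_mat_vec)
    then show "v $ i = (inverse (u \<bullet>c y) \<cdot>\<^sub>v u) $ i"
      using i u(1) adj s det by (simp add: v_def field_simps del: index_mult_mat_vec)
  qed (use u adj in \<open>auto simp: v_def\<close>)
qed

text \<open>
  Let \<open>v t\<close> be the eigenvector at time \<open>t\<close> with \<open>y\<^sup>* (v t) = 1\<close>, where \<open>y\<close> is the left eigenvector at
  the fixed time \<open>t0\<close>. Then \<open>ev t - ev t0 = y\<^sup>* (A t - A t0) (v t)\<close> holds exactly, and after division
  by \<open>t - t0\<close> only the continuity of \<open>v\<close> is required to pass to the limit.
\<close>

lemma simple_eigenvalue_has_vector_derivative:
  fixes A :: "real \<Rightarrow> complex mat" and ev :: "real \<Rightarrow> complex"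
  assumes t0: "t0 \<in> T" and A: "\<And>t. t \<in> T \<Longrightarrow> A t \<in> carrier_mat n n"
    and A': "A' \<in> carrier_mat n n"
    and deriv: "\<And>i j. i < n \<Longrightarrow> j < n \<Longrightarrow>
      ((\<lambda>t. A t $$ (i, j)) has_vector_derivative A' $$ (i, j)) (at t0 within T)"
    and cont: "(ev \<longlongrightarrow> ev t0) (at t0 within T)"
    and ev: "\<And>t. t \<in> T \<Longrightarrow> eigenvalue (A t) (ev t)"
    and simple: "simple_eigenvalue (A t0) (ev t0)"
    and x: "eigenvector (A t0) x (ev t0)" and y: "left_eigenvector (A t0) y (ev t0)"
  shows "(ev has_vector_derivative ((A' *\<^sub>v x) \<bullet>c y) / (x \<bullet>c y)) (at t0 within T)"
proof -
  note A0 = A[OF t0]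
  have xc: "x \<in> carrier_vec n" and yc: "y \<in> carrier_vec n"
    using x y A0 by (auto simp: eigenvector_def left_eigenvector_def)
  define G where "G t = bordered_mat n (A t) (ev t) x y" for t
  define v where "v t = inverse (det (G t)) \<cdot>\<^sub>v (adj_mat (G t) *\<^sub>v x)" for t
  have G: "G t \<in> carrier_mat n n" for t
    by (simp add: G_def)
  have vc: "v t \<in> carrier_vec n" for t
    by (simp add: v_def mult_mat_vec_carrier[of _ n n] adj_mat(1)[OF G] xc)
  have det0: "det (G t0) \<noteq> 0"
    unfolding G_def by (rule bordered_mat_det_nonzero[OF A0 simple x y])
  have lim_A: "((\<lambda>t. A t $$ (i, j)) \<longlongrightarrow> A t0 $$ (i, j)) (at t0 within T)" if "i < n" "j < n" for i j
    using has_vector_derivative_continuous[OF deriv[OF that]] by (simp add: continuous_within)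
  have lim_G: "((\<lambda>t. G t $$ (i, j)) \<longlongrightarrow> G t0 $$ (i, j)) (at t0 within T)" if "i < n" "j < n" for i j
    using that by (auto simp: G_def bordered_mat_def intro!: tendsto_intros lim_A cont)
  have lim_det: "((\<lambda>t. det (G t)) \<longlongrightarrow> det (G t0)) (at t0 within T)"
    by (rule tendsto_det[OF G G lim_G])
  have lim_v: "((\<lambda>t. v t $ i) \<longlongrightarrow> v t0 $ i) (at t0 within T)" if "i < n" for i
  proof -
    have "v t $ i = inverse (det (G t)) * (\<Sum>k<n. adj_mat (G t) $$ (i, k) * x $ k)" for t
      using that adj_mat(1)[OF G, of t] xc
      by (simp add: v_def scalar_prod_def atLeast0LessThan)
    then show ?thesis
      using that det0 by (auto intro!: tendsto_intros tendsto_adj_mat[OF G G lim_G] lim_det)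
  qed
  have v: "A t *\<^sub>v v t = ev t \<cdot>\<^sub>v v t" "v t \<bullet>c y = 1" if t: "t \<in> T" "det (G t) \<noteq> 0" for t
  proof -
    obtain u where u: "eigenvector (A t) u (ev t)"
      using ev[OF t(1)] by (auto simp: eigenvalue_def)
    then have uc: "u \<in> carrier_vec n" and Au: "A t *\<^sub>v u = ev t \<cdot>\<^sub>v u"
      using A[OF t(1)] by (auto simp: eigenvector_def)
    note sol = bordered_mat_solution[OF A[OF t(1)] xc yc u t(2)[unfolded G_def]]
    have v: "v t = inverse (u \<bullet>c y) \<cdot>\<^sub>v u"
      using sol(2) by (simp add: v_def G_def)
    show "A t *\<^sub>v v t = ev t \<cdot>\<^sub>v v t"
      unfolding v mult_mat_vec[OF A[OF t(1)] uc] Au by (simp add: smult_smult_assoc mult.commute)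
    show "v t \<bullet>c y = 1"
      unfolding v using uc yc sol(1) by simp
  qed
  have quotient: "(ev t - ev t0) /\<^sub>R (t - t0)
      = (\<Sum>i<n. \<Sum>j<n. cnj (y $ i) * ((A t $$ (i, j) - A t0 $$ (i, j)) /\<^sub>R (t - t0)) * v t $ j)"
    if t: "t \<in> T" "det (G t) \<noteq> 0" for t
  proof -
    have "ev t - ev t0 = (A t *\<^sub>v v t) \<bullet>c y - (A t0 *\<^sub>v v t) \<bullet>c y"
      using v[OF t] bilinear_form_left_eigenvector[OF A0 vc y] vc yc by simp
    also have "\<dots> = (\<Sum>i<n. \<Sum>j<n. cnj (y $ i) * (A t $$ (i, j) - A t0 $$ (i, j)) * v t $ j)"
      unfolding bilinear_form_sum[OF A[OF t(1)] vc yc] bilinear_form_sum[OF A0 vc yc]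
      by (simp add: sum_subtractf algebra_simps)
    finally show ?thesis
      by (simp add: scaleR_sum_right mult.assoc)
  qed
  have "((\<lambda>t. \<Sum>i<n. \<Sum>j<n. cnj (y $ i) * ((A t $$ (i, j) - A t0 $$ (i, j)) /\<^sub>R (t - t0)) * v t $ j)
      \<longlongrightarrow> (\<Sum>i<n. \<Sum>j<n. cnj (y $ i) * A' $$ (i, j) * v t0 $ j)) (at t0 within T)"
    using deriv[unfolded has_vector_derivative_iff_quotient]
    by (intro tendsto_sum tendsto_mult tendsto_const lim_v) auto
  then have "((\<lambda>t. (ev t - ev t0) /\<^sub>R (t - t0)) \<longlongrightarrow> (A' *\<^sub>v v t0) \<bullet>c y) (at t0 within T)"
    unfolding bilinear_form_sum[OF A' vc yc]
  proof (rule Lim_transform_eventually)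
    have "\<forall>\<^sub>F t in at t0 within T. det (G t) \<noteq> 0"
      using tendsto_imp_eventually_ne[OF lim_det det0] .
    moreover have "\<forall>\<^sub>F t in at t0 within T. t \<in> T"
      by (simp add: eventually_at_filter)
    ultimately show "\<forall>\<^sub>F t in at t0 within T.
        (\<Sum>i<n. \<Sum>j<n. cnj (y $ i) * ((A t $$ (i, j) - A t0 $$ (i, j)) /\<^sub>R (t - t0)) * v t $ j)
        = (ev t - ev t0) /\<^sub>R (t - t0)"
      by eventually_elim (simp add: quotient)
  qed
  moreover have "(A' *\<^sub>v v t0) \<bullet>c y = ((A' *\<^sub>v x) \<bullet>c y) / (x \<bullet>c y)"
  proof -
    have "v t0 = inverse (x \<bullet>c y) \<cdot>\<^sub>v x"
      using bordered_mat_solution(2)[OF A0 xc yc x det0[unfolded G_def]] by (simp add: v_def G_def)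
    then have "A' *\<^sub>v v t0 = inverse (x \<bullet>c y) \<cdot>\<^sub>v (A' *\<^sub>v x)"
      using mult_mat_vec[OF A' xc] by simp
    then show ?thesis
      using A' xc yc by (simp add: divide_inverse mult.commute)
  qed
  ultimately show ?thesis
    by (simp add: has_vector_derivative_iff_quotient)
qed

section \<open>Matrices with prescribed diagonal blocks\<close>

lemma block_position:
  fixes s :: "nat \<Rightarrow> nat"
  assumes "p < (\<Sum>l<K. s l)"
  obtains k a where "k < K" "a < s k" "p = (\<Sum>l<k. s l) + a"
  using assms
proof (induction K arbitrary: thesis)
  case (Suc K)
  show ?case
  proof (cases "p < (\<Sum>l<K. s l)")
    case True
    with Suc.IH obtain k a where "k < K" "a < s k" "p = (\<Sum>l<k. s l) + a"
      by blast
    then show ?thesis by (intro Suc.prems(1)[of k a]) auto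
  next
    case False
    then show ?thesis
      using Suc.prems(2) by (intro Suc.prems(1)[of K "p - (\<Sum>l<K. s l)"]) auto
  qed
qed simp

lemma sum_over_blocks:
  fixes s :: "nat \<Rightarrow> nat" and f :: "nat \<Rightarrow> 'a::comm_monoid_add"
  shows "(\<Sum>p<(\<Sum>l<K. s l). f p) = (\<Sum>k<K. \<Sum>a<s k. f ((\<Sum>l<k. s l) + a))"
proof (induction K)
  case (Suc K)
  have "(\<Sum>p<m + q. f p) = (\<Sum>p<m. f p) + (\<Sum>a<q. f (m + a))" for m q
    by (induction q) (simp_all add: add.assoc)
  with Suc show ?case by simp
qed simp

lemma index_diag_block_mat:
  fixes Bs :: "'a::zero mat list"
  assumes "k < length Bs" "k' < length Bs" "a < dim_row (Bs ! k)" "b < dim_col (Bs ! k')"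
  shows "diag_block_mat Bs $$ ((\<Sum>l<k. dim_row (Bs ! l)) + a, (\<Sum>l<k'. dim_col (Bs ! l)) + b)
       = (if k = k' then Bs ! k $$ (a, b) else 0)"
  using assms
proof (induction Bs arbitrary: k k')
  case (Cons B Bs)
  have bound: "(\<Sum>l<i. f (Cs ! l)) + c < sum_list (map f Cs)"
    if "i < length Cs" "c < f (Cs ! i)" for f :: "'a mat \<Rightarrow> nat" and Cs i c
  proof -
    have "(\<Sum>l<i. f (Cs ! l)) + c < (\<Sum>l<Suc i. f (Cs ! l))"
      using that by simp
    also have "\<dots> \<le> (\<Sum>l<length Cs. f (Cs ! l))"
      using that by (intro sum_mono2) auto
    finally show ?thesis
      by (simp add: sum_list_sum_nth atLeast0LessThan)
  qed
  show ?case
  proof (cases k; cases k')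
    fix i j assume [simp]: "k = Suc i" "k' = Suc j"
    have "(\<Sum>l<i. dim_row (Bs ! l)) + a < dim_row (diag_block_mat Bs)"
      "(\<Sum>l<j. dim_col (Bs ! l)) + b < dim_col (diag_block_mat Bs)"
      using Cons.prems bound[of i Bs a dim_row] bound[of j Bs b dim_col]
      by (simp_all add: dim_diag_block_mat)
    then show ?thesis
      using Cons.IH[of i j] Cons.prems
      by (simp add: Let_def sum.lessThan_Suc_shift add.assoc del: sum.lessThan_Suc)
  next
    fix j assume [simp]: "k = 0" "k' = Suc j"
    have "(\<Sum>l<j. dim_col (Bs ! l)) + b < dim_col (diag_block_mat Bs)"
      using Cons.prems bound[of j Bs b dim_col] by (simp add: dim_diag_block_mat)
    then show ?thesis
      using Cons.prems by (simp add: Let_def sum.lessThan_Suc_shift add.assoc del: sum.lessThan_Suc)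
  next
    fix i assume [simp]: "k = Suc i" "k' = 0"
    have "(\<Sum>l<i. dim_row (Bs ! l)) + a < dim_row (diag_block_mat Bs)"
      using Cons.prems bound[of i Bs a dim_row] by (simp add: dim_diag_block_mat)
    then show ?thesis
      using Cons.prems by (simp add: Let_def sum.lessThan_Suc_shift add.assoc del: sum.lessThan_Suc)
  qed (use Cons.prems in \<open>simp add: Let_def\<close>)
qed simp

text \<open>
  Scalar and full blocks under one numbering, so that block positions and sums need no distinction
  between the two kinds.
\<close>

definition structured_block ::
  "nat \<Rightarrow> (nat \<Rightarrow> nat) \<Rightarrow> (nat \<Rightarrow> complex) \<Rightarrow> (nat \<Rightarrow> complex mat) \<Rightarrow> nat \<Rightarrow> complex mat" where
  "structured_block S r d D k = (if k < S then d k \<cdot>\<^sub>m 1\<^sub>m (r k) else D (k - S))"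

lemma structured_mat_eq_diag_block_mat:
  "structured_mat S F r d D = diag_block_mat (map (structured_block S r d D) [0..<S + F])"
  unfolding structured_mat_def
  by (rule arg_cong[of _ _ diag_block_mat], rule nth_equalityI)
     (auto simp: structured_block_def nth_append)

lemma structured_block_carrier:
  assumes "\<And>j. j < F \<Longrightarrow> D j \<in> carrier_mat (m j) (m j)" "k < S + F"
  shows "structured_block S r d D k \<in> carrier_mat (block_size S r m k) (block_size S r m k)"
  using assms by (auto simp: structured_block_def block_size_def)

lemma sum_block_size: "(\<Sum>k<S + F. block_size S r m k) = (\<Sum>i<S. r i) + (\<Sum>j<F. m j)"
proof -
  have "(\<Sum>k<S + F. block_size S r m k) = (\<Sum>k<S. block_size S r m k) + (\<Sum>j<F. block_size S r m (S + j))"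
    by (induction F) (simp_all add: add.assoc)
  then show ?thesis by (simp add: block_size_def)
qed

lemma structured_mat_carrier:
  assumes D: "\<And>j. j < F \<Longrightarrow> D j \<in> carrier_mat (m j) (m j)"
    and n: "(\<Sum>i<S. r i) + (\<Sum>j<F. m j) = n"
  shows "structured_mat S F r d D \<in> carrier_mat n n"
proof -
  have "sum_list (map (\<lambda>k. dim_row (structured_block S r d D k)) [0..<S + F]) = n"
    "sum_list (map (\<lambda>k. dim_col (structured_block S r d D k)) [0..<S + F]) = n"
    using structured_block_carrier[of F D m _ S r d, OF D]
    unfolding n[symmetric] sum_block_size[symmetric]
    by (auto simp: interv_sum_list_conv_sum_set_nat atLeast0LessThan simp del: upt_Suc intro!: sum.cong)
  then show ?thesis
    by (auto simp: structured_mat_eq_diag_block_mat dim_diag_block_mat o_def)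
qed

lemma index_structured_mat:
  assumes D: "\<And>j. j < F \<Longrightarrow> D j \<in> carrier_mat (m j) (m j)"
    and k: "k < S + F" "k' < S + F" "a < block_size S r m k" "b < block_size S r m k'"
  shows "structured_mat S F r d D $$
      ((\<Sum>l<k. block_size S r m l) + a, (\<Sum>l<k'. block_size S r m l) + b)
    = (if k = k' then structured_block S r d D k $$ (a, b) else 0)"
proof -
  let ?Bs = "map (structured_block S r d D) [0..<S + F]"
  have dims: "dim_row (?Bs ! l) = block_size S r m l" "dim_col (?Bs ! l) = block_size S r m l"
    if "l < S + F" for l
    using structured_block_carrier[of F D m l S r d, OF D] that by auto
  have "(\<Sum>l<i. dim_row (?Bs ! l)) = (\<Sum>l<i. block_size S r m l)"
    "(\<Sum>l<i. dim_col (?Bs ! l)) = (\<Sum>l<i. block_size S r m l)" if "i < S + F" for i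
    using that dims by (auto intro!: sum.cong)
  then show ?thesis
    using index_diag_block_mat[of k ?Bs k' a b] k dims
    by (simp add: structured_mat_eq_diag_block_mat del: upt_Suc)
qed

text \<open>
  The sizes of the scalar blocks have to be positive, since the scalar of an empty block leaves no
  trace in the matrix.
\<close>

lemma structured_mat_inject:
  assumes r: "\<And>i. i < S \<Longrightarrow> r i > 0"
    and D: "\<And>j. j < F \<Longrightarrow> D j \<in> carrier_mat (m j) (m j)"
    and D': "\<And>j. j < F \<Longrightarrow> D' j \<in> carrier_mat (m j) (m j)"
    and eq: "structured_mat S F r d D = structured_mat S F r d' D'"
  shows "i < S \<Longrightarrow> d i = d' i" and "j < F \<Longrightarrow> D j = D' j"
proof -
  have entry: "structured_block S r d D k $$ (a, b) = structured_block S r d' D' k $$ (a, b)"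
    if "k < S + F" "a < block_size S r m k" "b < block_size S r m k" for k a b
    using index_structured_mat[where F=F and D=D and m=m and S=S and k=k and k'=k and a=a and b=b and r=r and d=d, OF D]
      index_structured_mat[where F=F and D=D' and m=m and S=S and k=k and k'=k and a=a and b=b and r=r and d=d', OF D'] that eq
    by simp
  show "d i = d' i" if "i < S"
    using entry[of i 0 0] r[OF that] that by (simp add: structured_block_def block_size_def)
  show "D j = D' j" if "j < F"
  proof (rule eq_matI)
    fix a b assume "a < dim_row (D' j)" "b < dim_col (D' j)"
    then show "D j $$ (a, b) = D' j $$ (a, b)"
      using entry[of "S + j" a b] D'[OF that] that by (simp add: structured_block_def block_size_def)
  qed (use D[OF that] D'[OF that] in auto)
qed

text \<open>
  Membership in the constraint set asserts the norm conditions for some family of blocks; by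
  injectivity that family is the given one.
\<close>

lemma B1_star_blocks:
  assumes r: "\<And>i. i < S \<Longrightarrow> r i > 0"
    and D: "\<And>j. j < F \<Longrightarrow> D j \<in> carrier_mat (m j) (m j)"
    and B1: "structured_mat S F r d D \<in> B1_star S F r m"
  shows "i < S \<Longrightarrow> cmod (d i) = 1" and "j < F \<Longrightarrow> frob_norm (D j) = 1"
proof -
  obtain d' D' where eq: "structured_mat S F r d D = structured_mat S F r d' D'"
    and d': "\<And>i. i < S \<Longrightarrow> cmod (d' i) = 1"
    and D': "\<And>j. j < F \<Longrightarrow> D' j \<in> carrier_mat (m j) (m j)" "\<And>j. j < F \<Longrightarrow> frob_norm (D' j) = 1"
    using B1 unfolding B1_star_def by blast
  note inj = structured_mat_inject[of S r F D m D' d d', OF r D D'(1) eq]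
  show "i < S \<Longrightarrow> cmod (d i) = 1" using inj(1) d' by simp
  show "j < F \<Longrightarrow> frob_norm (D j) = 1" using inj(2) D' by simp
qed

lemma structured_mat_bilinear_form:
  assumes D: "\<And>j. j < F \<Longrightarrow> D j \<in> carrier_mat (m j) (m j)"
    and n: "(\<Sum>i<S. r i) + (\<Sum>j<F. m j) = n"
    and x: "x \<in> carrier_vec n" and z: "z \<in> carrier_vec n"
  shows "(structured_mat S F r d D *\<^sub>v x) \<bullet>c z
    = (\<Sum>i<S. d i * (vec_block S r m x i \<bullet>c vec_block S r m z i))
      + (\<Sum>j<F. (D j *\<^sub>v vec_block S r m x (S + j)) \<bullet>c vec_block S r m z (S + j))"
proof -
  let ?s = "block_size S r m" and ?E = "structured_mat S F r d D"
  let ?o = "\<lambda>k. \<Sum>l<k. ?s l"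
  let ?B = "structured_block S r d D" and ?x = "vec_block S r m x" and ?z = "vec_block S r m z"
  have n': "(\<Sum>k<S + F. ?s k) = n"
    using n by (simp add: sum_block_size)
  have E: "?E \<in> carrier_mat n n"
    using structured_mat_carrier[OF D n] by simp
  have row: "(\<Sum>q<n. ?E $$ (?o k + a, q) * x $ q) = (\<Sum>b<?s k. ?B k $$ (a, b) * ?x k $ b)"
    if "k < S + F" "a < ?s k" for k a
  proof -
    have "(\<Sum>q<n. ?E $$ (?o k + a, q) * x $ q)
        = (\<Sum>k'<S + F. \<Sum>b<?s k'. if k = k' then ?B k $$ (a, b) * ?x k $ b else 0)"
      unfolding n'[symmetric] sum_over_blocks
      using that by (intro sum.cong) (auto simp: index_structured_mat[where m = m, OF D] vec_block_def)
    also have "\<dots> = (\<Sum>k'<S + F. if k = k' then \<Sum>b<?s k'. ?B k $$ (a, b) * ?x k $ b else 0)"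
      by (intro sum.cong) auto
    finally show ?thesis using that by simp
  qed
  have "(?E *\<^sub>v x) \<bullet>c z = (\<Sum>p<n. (\<Sum>q<n. ?E $$ (p, q) * x $ q) * cnj (z $ p))"
    using E x z by (simp add: scalar_prod_def atLeast0LessThan)
  also have "\<dots> = (\<Sum>k<S + F. \<Sum>a<?s k. (\<Sum>q<n. ?E $$ (?o k + a, q) * x $ q) * cnj (z $ (?o k + a)))"
    unfolding n'[symmetric] sum_over_blocks[of _ ?s "S + F"] ..
  also have "\<dots> = (\<Sum>k<S + F. \<Sum>a<?s k. (\<Sum>b<?s k. ?B k $$ (a, b) * ?x k $ b) * cnj (?z k $ a))"
    by (intro sum.cong refl) (simp add: row vec_block_def)
  also have "\<dots> = (\<Sum>k<S + F. (?B k *\<^sub>v ?x k) \<bullet>c ?z k)"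
  proof (intro sum.cong refl)
    fix k assume "k \<in> {..<S + F}"
    then have "?B k \<in> carrier_mat (?s k) (?s k)"
      using structured_block_carrier[of F D m k S r d, OF D] by simp
    then show "(\<Sum>a<?s k. (\<Sum>b<?s k. ?B k $$ (a, b) * ?x k $ b) * cnj (?z k $ a)) = (?B k *\<^sub>v ?x k) \<bullet>c ?z k"
      by (simp add: scalar_prod_def atLeast0LessThan vec_block_def)
  qed
  also have "\<dots> = (\<Sum>k<S. (?B k *\<^sub>v ?x k) \<bullet>c ?z k) + (\<Sum>j<F. (?B (S + j) *\<^sub>v ?x (S + j)) \<bullet>c ?z (S + j))"
    by (induction F) (simp_all add: add.assoc)
  also have "(\<Sum>k<S. (?B k *\<^sub>v ?x k) \<bullet>c ?z k) = (\<Sum>i<S. d i * (?x i \<bullet>c ?z i))"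
  proof (intro sum.cong refl)
    fix i assume "i \<in> {..<S}"
    then have c: "?x i \<in> carrier_vec (r i)" "?z i \<in> carrier_vec (r i)" and "?B i = d i \<cdot>\<^sub>m 1\<^sub>m (r i)"
      by (auto simp: vec_block_def block_size_def structured_block_def)
    moreover from c have "(d i \<cdot>\<^sub>m 1\<^sub>m (r i)) *\<^sub>v ?x i = d i \<cdot>\<^sub>v ?x i"
      by (intro eq_vecI) auto
    ultimately show "(?B i *\<^sub>v ?x i) \<bullet>c ?z i = d i * (?x i \<bullet>c ?z i)"
      by simp
  qed
  finally show ?thesis
    by (simp add: structured_block_def)
qed

lemma structured_mat_has_vector_derivative:
  fixes d :: "real \<Rightarrow> nat \<Rightarrow> complex" and D :: "real \<Rightarrow> nat \<Rightarrow> complex mat"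
  assumes t: "t \<in> T" and n: "(\<Sum>i<S. r i) + (\<Sum>j<F. m j) = n"
    and D: "\<And>s j. s \<in> T \<Longrightarrow> j < F \<Longrightarrow> D s j \<in> carrier_mat (m j) (m j)"
    and D': "\<And>j. j < F \<Longrightarrow> D' j \<in> carrier_mat (m j) (m j)"
    and d_deriv: "\<And>i. i < S \<Longrightarrow> ((\<lambda>s. d s i) has_vector_derivative d' i) (at t within T)"
    and D_deriv: "\<And>j a b. j < F \<Longrightarrow> a < m j \<Longrightarrow> b < m j \<Longrightarrow>
      ((\<lambda>s. D s j $$ (a, b)) has_vector_derivative D' j $$ (a, b)) (at t within T)"
    and pq: "p < n" "q < n"
  shows "((\<lambda>s. structured_mat S F r (d s) (D s) $$ (p, q)) has_vector_derivative
      structured_mat S F r d' D' $$ (p, q)) (at t within T)"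
proof -
  let ?s = "block_size S r m"
  have n': "(\<Sum>k<S + F. ?s k) = n"
    using n by (simp add: sum_block_size)
  obtain k a where k: "k < S + F" "a < ?s k" "p = (\<Sum>l<k. ?s l) + a"
    using block_position[of p ?s "S + F"] pq n' by auto
  obtain k' b where k': "k' < S + F" "b < ?s k'" "q = (\<Sum>l<k'. ?s l) + b"
    using block_position[of q ?s "S + F"] pq n' by auto
  note index = index_structured_mat[where m = m and k = k and k' = k' and a = a and b = b,
      OF _ k(1) k'(1) k(2) k'(2), folded k(3) k'(3)]
  have "((\<lambda>s. structured_block S r (d s) (D s) k $$ (a, b)) has_vector_derivative
      structured_block S r d' D' k $$ (a, b)) (at t within T)" if "k = k'"
    using that k k' d_deriv[of k] D_deriv[of "k - S" a b]
    by (cases "k < S") (simp_all add: structured_block_def block_size_def)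
  then have block: "((\<lambda>s. if k = k' then structured_block S r (d s) (D s) k $$ (a, b) else 0)
      has_vector_derivative structured_mat S F r d' D' $$ (p, q)) (at t within T)"
    by (simp add: index[OF D'])
  have "structured_mat S F r (d s) (D s) $$ (p, q)
      = (if k = k' then structured_block S r (d s) (D s) k $$ (a, b) else 0)" if "s \<in> T" for s
    by (rule index) (rule D[OF that])
  from this block show ?thesis
    by (rule has_vector_derivative_transform[OF t])
qed

section \<open>Each block moves along a projected gradient\<close>

lemma index_mat_adjoint:
  fixes A :: "complex mat"
  assumes "i < dim_col A" "j < dim_row A"
  shows "mat_adjoint A $$ (i, j) = cnj (A $$ (j, i))"
  using assms by (simp add: mat_adjoint_def mat_of_rows_def)

lemma mat_adjoint_carrier:
  fixes A :: "complex mat"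
  shows "A \<in> carrier_mat nr nc \<Longrightarrow> mat_adjoint A \<in> carrier_mat nc nr"
  by (auto simp: mat_adjoint_def)

lemma mult_mat_vec_cscalar_prod_adjoint:
  fixes A :: "complex mat"
  assumes A: "A \<in> carrier_mat n m" and u: "u \<in> carrier_vec m" and y: "y \<in> carrier_vec n"
  shows "(A *\<^sub>v u) \<bullet>c y = u \<bullet>c (mat_adjoint A *\<^sub>v y)"
proof -
  have "conjugate (mat_adjoint A *\<^sub>v y) = transpose_mat A *\<^sub>v conjugate y"
    using A y mat_adjoint_carrier[OF A]
    by (intro eq_vecI) (auto simp: scalar_prod_def index_mat_adjoint intro!: sum.cong)
  then show ?thesis
    using transpose_vec_mult_scalar[OF A u, of "conjugate y"] A u y
      comm_scalar_prod[of "A *\<^sub>v u" n "conjugate y"] comm_scalar_prod[of u m "transpose_mat A *\<^sub>v conjugate y"]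
    by simp
qed

lemma smult_mat_mult_vec:
  fixes A :: "'a::comm_ring mat"
  assumes "A \<in> carrier_mat n m" "u \<in> carrier_vec m"
  shows "(c \<cdot>\<^sub>m A) *\<^sub>v u = c \<cdot>\<^sub>v (A *\<^sub>v u)"
  using assms by (intro eq_vecI) auto

text \<open>
  For a unit vector \<open>D\<close>, the vector \<open>R - c D\<close> is the projection of \<open>R\<close> onto the real orthogonal
  complement of \<open>D\<close>, so its real inner product with \<open>R\<close> equals its own squared norm.
\<close>

lemma tangent_projection_nonneg:
  fixes D R :: "'a \<Rightarrow> complex"
  assumes D: "(\<Sum>i\<in>I. (cmod (D i))\<^sup>2) = 1"
  defines "c \<equiv> Re (\<Sum>i\<in>I. cnj (D i) * R i)"
  shows "Re (\<Sum>i\<in>I. cnj (R i) * (R i - complex_of_real c * D i)) \<ge> 0"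
proof -
  have "(cmod (R i - complex_of_real c * D i))\<^sup>2
      = Re (cnj (R i) * (R i - complex_of_real c * D i)) - c * Re (cnj (D i) * R i) + c\<^sup>2 * (cmod (D i))\<^sup>2" for i
    unfolding cmod_power2 by (simp add: power2_eq_square algebra_simps)
  then have "(\<Sum>i\<in>I. (cmod (R i - complex_of_real c * D i))\<^sup>2)
      = Re (\<Sum>i\<in>I. cnj (R i) * (R i - complex_of_real c * D i)) - c * c + c\<^sup>2"
    using D by (simp add: c_def sum.distrib sum_subtractf sum_distrib_left[symmetric])
  moreover have "(\<Sum>i\<in>I. (cmod (R i - complex_of_real c * D i))\<^sup>2) \<ge> 0"
    by (intro sum_nonneg) simp
  ultimately show ?thesis
    by (simp add: power2_eq_square)
qed

lemma frob_inner_sum: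
  assumes A: "A \<in> carrier_mat n m" and B: "B \<in> carrier_mat n m"
  shows "frob_inner A B = (\<Sum>(a, b)\<in>{..<n} \<times> {..<m}. cnj (A $$ (a, b)) * B $$ (a, b))"
proof -
  have "frob_inner A B = (\<Sum>b<m. \<Sum>a<n. cnj (A $$ (a, b)) * B $$ (a, b))"
    using assms mat_adjoint_carrier[OF A]
    by (simp add: frob_inner_def mat_trace_def scalar_prod_def atLeast0LessThan index_mat_adjoint)
  also have "\<dots> = (\<Sum>a<n. \<Sum>b<m. cnj (A $$ (a, b)) * B $$ (a, b))"
    by (rule sum.swap)
  finally show ?thesis
    by (simp add: sum.cartesian_product)
qed

lemma Re_frob_inner_self:
  assumes A: "A \<in> carrier_mat n m"
  shows "Re (frob_inner A A) = (\<Sum>(a, b)\<in>{..<n} \<times> {..<m}. (cmod (A $$ (a, b)))\<^sup>2)"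
proof -
  have "Re (cnj c * c) = (cmod c)\<^sup>2" for c
    unfolding cmod_power2 by (simp add: power2_eq_square)
  then show ?thesis
    unfolding frob_inner_sum[OF A A] Re_sum by (intro sum.cong) auto
qed

lemma recip_or_one_nonneg: "0 \<le> c \<Longrightarrow> 0 \<le> recip_or_one c"
  by (simp add: recip_or_one_def)

lemma full_block_rhs_carrier:
  assumes "D \<in> carrier_mat n n" "x \<in> carrier_vec n" "z \<in> carrier_vec n"
  shows "full_block_rhs x z D \<in> carrier_mat n n"
  using assms by (auto simp: full_block_rhs_def rank_one_def Let_def)

text \<open>
  The projection argument in one complex dimension: \<open>x \<bullet>c z\<close> is the conjugate of the vector that
  is projected.
\<close>

lemma scalar_block_rhs_nonneg:
  assumes d: "cmod d = 1" and x: "x \<in> carrier_vec n" and z: "z \<in> carrier_vec n"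
  shows "Re (scalar_block_rhs x z d * (x \<bullet>c z)) \<ge> 0"
proof -
  let ?e = "z \<bullet>c x"
  let ?w = "?e - complex_of_real (Re (?e * cnj d)) * d"
  have "x \<bullet>c z = cnj ?e"
    using x z by (simp add: scalar_prod_def mult.commute)
  then have "scalar_block_rhs x z d * (x \<bullet>c z)
      = complex_of_real (recip_or_one (cmod ?w)) * (cnj ?e * ?w)"
    by (simp add: scalar_block_rhs_def Let_def mult_ac)
  moreover have "Re (cnj ?e * ?w) \<ge> 0"
    using tangent_projection_nonneg[of "\<lambda>_. d" "{()}" "\<lambda>_. ?e"] d by (simp add: mult.commute)
  moreover have "recip_or_one (cmod ?w) \<ge> 0"
    by (rule recip_or_one_nonneg) simp
  moreover have "Re (complex_of_real a * v) = a * Re v" for a v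
    by simp
  ultimately show ?thesis
    by (simp only: mult_nonneg_nonneg)
qed

text \<open>
  The bilinear form in \<open>x\<close> and \<open>z\<close> is the Frobenius inner product with \<open>z x\<^sup>*\<close>, so this is the projection
  argument in the space of matrices.
\<close>

lemma full_block_rhs_nonneg:
  assumes D: "D \<in> carrier_mat n n" "frob_norm D = 1"
    and x: "x \<in> carrier_vec n" and z: "z \<in> carrier_vec n"
  shows "Re ((full_block_rhs x z D *\<^sub>v x) \<bullet>c z) \<ge> 0"
proof -
  let ?R = "rank_one z x"
  let ?c = "Re (frob_inner D ?R)"
  let ?E = "?R - complex_of_real ?c \<cdot>\<^sub>m D"
  have R: "?R \<in> carrier_mat n n" and E: "?E \<in> carrier_mat n n"
    using x z D by (auto simp: rank_one_def)
  have ind: "?R $$ (a, b) = z $ a * cnj (x $ b)" if "a < n" "b < n" for a b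
    using that x z by (simp add: rank_one_def)
  have "(\<Sum>p\<in>{..<n} \<times> {..<n}. (cmod (D $$ p))\<^sup>2) = 1"
    using D(2) Re_frob_inner_self[OF D(1)] by (simp add: frob_norm_def case_prod_beta)
  from tangent_projection_nonneg[OF this, of "\<lambda>p. ?R $$ p"]
  have "0 \<le> Re (\<Sum>(a, b)\<in>{..<n} \<times> {..<n}. cnj (?R $$ (a, b)) * (?R $$ (a, b) - complex_of_real ?c * D $$ (a, b)))"
    by (simp add: frob_inner_sum[OF D(1) R] case_prod_beta)
  also have "(\<Sum>(a, b)\<in>{..<n} \<times> {..<n}. cnj (?R $$ (a, b)) * (?R $$ (a, b) - complex_of_real ?c * D $$ (a, b)))
      = (\<Sum>a<n. \<Sum>b<n. cnj (z $ a) * ?E $$ (a, b) * x $ b)"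
    unfolding sum.cartesian_product[symmetric]
    using D(1) R by (intro sum.cong refl) (simp add: ind mult_ac)
  also have "\<dots> = (?E *\<^sub>v x) \<bullet>c z"
    by (rule bilinear_form_sum[OF E x z, symmetric])
  finally have nonneg: "0 \<le> Re ((?E *\<^sub>v x) \<bullet>c z)" .
  define \<rho> where "\<rho> = recip_or_one (frob_norm ?E)"
  have "\<rho> \<ge> 0"
    unfolding \<rho>_def frob_norm_def Re_frob_inner_self[OF E]
    by (intro recip_or_one_nonneg real_sqrt_ge_zero sum_nonneg) auto
  have "full_block_rhs x z D = complex_of_real \<rho> \<cdot>\<^sub>m ?E"
    by (simp add: full_block_rhs_def Let_def \<rho>_def)
  moreover have "(complex_of_real \<rho> \<cdot>\<^sub>m ?E) *\<^sub>v x = complex_of_real \<rho> \<cdot>\<^sub>v (?E *\<^sub>v x)"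
    by (rule smult_mat_mult_vec[OF E x])
  ultimately have "(full_block_rhs x z D *\<^sub>v x) \<bullet>c z = complex_of_real \<rho> * ((?E *\<^sub>v x) \<bullet>c z)"
    using smult_scalar_prod_distrib[of "?E *\<^sub>v x" n "conjugate z"] E x z
    by (simp only: mult_mat_vec_carrier carrier_vec_conjugate)
  then show ?thesis
    using nonneg \<open>\<rho> \<ge> 0\<close> by simp
qed

section \<open>Monotonicity of the modulus\<close>

lemma mono_on_interval_if_derivative_nonneg:
  fixes f :: "real \<Rightarrow> real"
  assumes T: "is_interval T"
    and deriv: "\<And>t. t \<in> T \<Longrightarrow> (f has_real_derivative f' t) (at t within T)"
    and nonneg: "\<And>t. t \<in> T \<Longrightarrow> 0 \<le> f' t"
  shows "mono_on T f"
proof (rule mono_onI)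
  fix a b assume ab: "a \<in> T" "b \<in> T" "a \<le> b"
  then have sub: "{a..b} \<subseteq> T"
    using T ab unfolding is_interval_1 by (meson atLeastAtMost_iff subsetI)
  have "(f has_derivative (*) (f' t)) (at t within {a..b})" if "a \<le> t" "t \<le> b" for t
    using DERIV_subset[OF deriv sub] that sub by (auto simp: has_field_derivative_def)
  from mvt_very_simple[OF ab(3) this] obtain t where "t \<in> {a..b}" "f b - f a = f' t * (b - a)"
    by auto
  then show "f a \<le> f b"
    using nonneg[of t] sub ab(3) by (metis diff_ge_0_iff_ge mult_nonneg_nonneg subsetD)
qed

theorem theorem3p8:
  fixes S F n :: nat and r m :: "nat \<Rightarrow> nat"
    and M :: "complex mat" and \<epsilon> :: real
    and T :: "real set"
    and \<Delta> :: "real \<Rightarrow> complex mat"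
    and d :: "real \<Rightarrow> nat \<Rightarrow> complex" and D :: "real \<Rightarrow> nat \<Rightarrow> complex mat"
    and ev :: "real \<Rightarrow> complex" and \<theta> :: "real \<Rightarrow> real"
    and x y z :: "real \<Rightarrow> complex vec"
  assumes r_pos: "\<And>i. i < S \<Longrightarrow> r i > 0"
    and m_pos: "\<And>j. j < F \<Longrightarrow> m j > 0"
    and sizes: "(\<Sum>i<S. r i) + (\<Sum>j<F. m j) = n"
    and M: "M \<in> carrier_mat n n"
    and eps: "\<epsilon> > 0"
    and T: "is_interval T"
    and blocks: "\<And>t. t \<in> T \<Longrightarrow> \<Delta> t = structured_mat S F r (d t) (D t)"
    and full_blocks: "\<And>t j. t \<in> T \<Longrightarrow> j < F \<Longrightarrow> D t j \<in> carrier_mat (m j) (m j)"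
    and in_B1: "\<And>t. t \<in> T \<Longrightarrow> \<Delta> t \<in> B1_star S F r m"
    and branch: "continuous_on T ev"
    and simple: "\<And>t. t \<in> T \<Longrightarrow>
       simple_eigenvalue (complex_of_real \<epsilon> \<cdot>\<^sub>m (M * \<Delta> t)) (ev t)"
    and eigvecs: "\<And>t. t \<in> T \<Longrightarrow>
       normalized_eigenvectors (complex_of_real \<epsilon> \<cdot>\<^sub>m (M * \<Delta> t)) (ev t) (\<theta> t) (x t) (y t)"
    and z: "\<And>t. t \<in> T \<Longrightarrow> z t = mat_adjoint M *\<^sub>v y t"
    and ode_scalar: "\<And>t i. t \<in> T \<Longrightarrow> i < S \<Longrightarrow>
       ((\<lambda>s. d s i) has_vector_derivative
          scalar_block_rhs (vec_block S r m (x t) i) (vec_block S r m (z t) i) (d t i))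
       (at t within T)"
    and ode_full: "\<And>t j k l. t \<in> T \<Longrightarrow> j < F \<Longrightarrow> k < m j \<Longrightarrow> l < m j \<Longrightarrow>
       ((\<lambda>s. D s j $$ (k, l)) has_vector_derivative
          full_block_rhs (vec_block S r m (x t) (S + j)) (vec_block S r m (z t) (S + j)) (D t j)
            $$ (k, l))
       (at t within T)"
  shows "mono_on T (\<lambda>t. cmod (ev t))"
proof -
  define A where "A t = complex_of_real \<epsilon> \<cdot>\<^sub>m (M * \<Delta> t)" for t
  have \<Delta>: "\<Delta> t \<in> carrier_mat n n" if "t \<in> T" for t
    using structured_mat_carrier[OF full_blocks[OF that] sizes] blocks[OF that] by simp
  have A: "A t \<in> carrier_mat n n" if "t \<in> T" for t
    using M \<Delta>[OF that] by (simp add: A_def)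
  have key: "\<exists>ev'. (ev has_vector_derivative ev') (at t within T) \<and> 0 \<le> Re (cnj (ev t) * ev')"
    if t: "t \<in> T" for t
  proof -
    have ev_polar: "ev t = complex_of_real (cmod (ev t)) * cis (\<theta> t)"
      and x: "eigenvector (A t) (x t) (ev t)" and y: "left_eigenvector (A t) (y t) (ev t)"
      and xy_polar: "x t \<bullet>c y t = complex_of_real (cmod (x t \<bullet>c y t)) * cis (- \<theta> t)"
      using eigvecs[OF t] by (simp_all add: normalized_eigenvectors_def A_def)
    have xc: "x t \<in> carrier_vec n" and yc: "y t \<in> carrier_vec n"
      using x y A[OF t] by (auto simp: eigenvector_def left_eigenvector_def)
    have zc: "z t \<in> carrier_vec n"
      using z[OF t] mat_adjoint_carrier[OF M] yc by (auto intro: mult_mat_vec_carrier)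
    define d' where
      "d' i = scalar_block_rhs (vec_block S r m (x t) i) (vec_block S r m (z t) i) (d t i)" for i
    define D' where "D' j = full_block_rhs (vec_block S r m (x t) (S + j))
        (vec_block S r m (z t) (S + j)) (D t j)" for j
    have block_full: "vec_block S r m v (S + j) \<in> carrier_vec (m j)" for v j
      by (simp add: vec_block_def block_size_def)
    have block_scalar: "vec_block S r m v i \<in> carrier_vec (r i)" if "i < S" for v i
      using that by (simp add: vec_block_def block_size_def)
    have D': "D' j \<in> carrier_mat (m j) (m j)" if "j < F" for j
      unfolding D'_def by (intro full_block_rhs_carrier full_blocks t that block_full)
    define E where "E = structured_mat S F r d' D'"
    have E: "E \<in> carrier_mat n n"
      unfolding E_def by (rule structured_mat_carrier[OF D' sizes])
    have E_deriv: "((\<lambda>s. \<Delta> s $$ (p, q)) has_vector_derivative E $$ (p, q)) (at t within T)"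
      if "p < n" "q < n" for p q
    proof (rule has_vector_derivative_transform[OF t])
      show "\<Delta> s $$ (p, q) = structured_mat S F r (d s) (D s) $$ (p, q)" if "s \<in> T" for s
        using blocks[OF that] by simp
      show "((\<lambda>s. structured_mat S F r (d s) (D s) $$ (p, q)) has_vector_derivative E $$ (p, q))
          (at t within T)"
        unfolding E_def
        by (rule structured_mat_has_vector_derivative[OF t sizes full_blocks D'])
           (use ode_scalar[OF t] ode_full[OF t] that in \<open>auto simp: d'_def D'_def\<close>)
    qed
    define A' where "A' = complex_of_real \<epsilon> \<cdot>\<^sub>m (M * E)"
    have A': "A' \<in> carrier_mat n n"
      using M E by (simp add: A'_def)
    have A_deriv: "((\<lambda>s. A s $$ (p, q)) has_vector_derivative A' $$ (p, q)) (at t within T)"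
      if pq: "p < n" "q < n" for p q
    proof (rule has_vector_derivative_transform[OF t])
      show "A s $$ (p, q) = complex_of_real \<epsilon> * (\<Sum>k<n. M $$ (p, k) * \<Delta> s $$ (k, q))" if "s \<in> T" for s
        using pq M \<Delta>[OF that] by (simp add: A_def scalar_prod_def atLeast0LessThan)
      have "A' $$ (p, q) = complex_of_real \<epsilon> * (\<Sum>k<n. M $$ (p, k) * E $$ (k, q))"
        using pq M E by (simp add: A'_def scalar_prod_def atLeast0LessThan)
      then show "((\<lambda>s. complex_of_real \<epsilon> * (\<Sum>k<n. M $$ (p, k) * \<Delta> s $$ (k, q)))
          has_vector_derivative A' $$ (p, q)) (at t within T)"
        using pq
        by (auto intro!: has_vector_derivative_mult_right has_vector_derivative_sum E_deriv)
    qed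
    define w where "w = (E *\<^sub>v x t) \<bullet>c z t"
    have pairing: "x t \<bullet>c y t \<noteq> 0"
      by (rule simple_eigenvalue_pairing_nonzero[OF A[OF t] simple[OF t, folded A_def] x y])
    have "(A' *\<^sub>v x t) \<bullet>c y t = complex_of_real \<epsilon> * w"
    proof -
      have "A' *\<^sub>v x t = complex_of_real \<epsilon> \<cdot>\<^sub>v (M *\<^sub>v (E *\<^sub>v x t))"
        unfolding A'_def assoc_mult_mat_vec[OF M E xc, symmetric]
        by (rule smult_mat_mult_vec[OF mult_carrier_mat[OF M E] xc])
      then show ?thesis
        using M E xc yc mult_mat_vec_cscalar_prod_adjoint[OF M, of "E *\<^sub>v x t" "y t"]
        by (simp add: w_def z[OF t])
    qed
    moreover have "(ev has_vector_derivative ((A' *\<^sub>v x t) \<bullet>c y t) / (x t \<bullet>c y t)) (at t within T)"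
    proof (rule simple_eigenvalue_has_vector_derivative[where A = A and ev = ev and n = n,
          OF t A A' A_deriv _ _ _ x y])
      show "(ev \<longlongrightarrow> ev t) (at t within T)"
        using branch t by (simp add: continuous_on_def)
      show "eigenvalue (A s) (ev s)" if "s \<in> T" for s
        using eigvecs[OF that] by (auto simp: normalized_eigenvectors_def eigenvalue_def A_def)
      show "simple_eigenvalue (A t) (ev t)"
        using simple[OF t] by (simp add: A_def)
    qed
    ultimately have "(ev has_vector_derivative complex_of_real \<epsilon> * w / (x t \<bullet>c y t)) (at t within T)"
      by simp
    (* The polar form of the eigenvalue and the normalization carry the same phase, which cancels;
       for a zero eigenvalue both sides vanish whatever angle is chosen. *)
    moreover have "cnj (ev t) * (complex_of_real \<epsilon> * w / (x t \<bullet>c y t))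
        = complex_of_real (cmod (ev t) * \<epsilon> / cmod (x t \<bullet>c y t)) * w"
    proof -
      have "cnj (ev t) = complex_of_real (cmod (ev t)) * cis (- \<theta> t)"
        by (subst ev_polar) (simp add: cis_cnj)
      then show ?thesis
        by (subst xy_polar) simp
    qed
    moreover have "0 \<le> Re w"
    proof -
      note unit = B1_star_blocks[of S r F "D t" m "d t", OF r_pos full_blocks[OF t]
          in_B1[OF t, unfolded blocks[OF t]]]
      have "0 \<le> Re (d' i * (vec_block S r m (x t) i \<bullet>c vec_block S r m (z t) i))" if "i < S" for i
        unfolding d'_def using that
        by (intro scalar_block_rhs_nonneg[of _ _ "r i"] unit block_scalar)
      moreover have "0 \<le> Re ((D' j *\<^sub>v vec_block S r m (x t) (S + j)) \<bullet>c vec_block S r m (z t) (S + j))"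
        if "j < F" for j
        unfolding D'_def using that
        by (intro full_block_rhs_nonneg[of _ "m j"] unit full_blocks t block_full)
      moreover have "w = (\<Sum>i<S. d' i * (vec_block S r m (x t) i \<bullet>c vec_block S r m (z t) i))
          + (\<Sum>j<F. (D' j *\<^sub>v vec_block S r m (x t) (S + j)) \<bullet>c vec_block S r m (z t) (S + j))"
        unfolding w_def E_def by (rule structured_mat_bilinear_form[OF D' sizes xc zc])
      ultimately show ?thesis
        by (simp only: plus_complex.sel Re_sum) (intro add_nonneg_nonneg sum_nonneg, simp_all only: lessThan_iff)
    qed
    ultimately show ?thesis
      using eps by (intro exI[of _ "complex_of_real \<epsilon> * w / (x t \<bullet>c y t)"]) simp
  qed
  then obtain ev' where ev': "\<And>t. t \<in> T \<Longrightarrow> (ev has_vector_derivative ev' t) (at t within T)"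
    and nonneg: "\<And>t. t \<in> T \<Longrightarrow> 0 \<le> Re (cnj (ev t) * ev' t)"
    by metis
  have "mono_on T (\<lambda>t. (cmod (ev t))\<^sup>2)"
  proof (rule mono_on_interval_if_derivative_nonneg[OF T])
    fix t assume t: "t \<in> T"
    show "((\<lambda>t. (cmod (ev t))\<^sup>2) has_real_derivative 2 * Re (cnj (ev t) * ev' t)) (at t within T)"
      unfolding cmod_power2 by (auto intro!: derivative_eq_intros ev'[OF t])
    show "0 \<le> 2 * Re (cnj (ev t) * ev' t)"
      using nonneg[OF t] by simp
  qed
  then show ?thesis
    by (auto simp: mono_on_def)
qed

end
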